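(* Let $A$ be a finite-dimensional (left) Leibniz algebra over a field $F$, let $N$ be a (two-sided) ideal of $A$ and let $C$ be a Cartan subalgebra of $N$. Then $N+\mathcal{N}_A(C)=A$.
   Context: $F$ is an arbitrary field. A (left) Leibniz algebra is a vector space $A$ over $F$ with a bilinear product satisfying $a(bc)=(ab)c+b(ac)$ for all $a,b,c\in A$. A Leibniz algebra $B$ is nilpotent if $B^k=0$ for some $k$, where $B^1=B$, $B^{k+1}=BB^k$. The normaliser of a subalgebra $U$ in $A$ is $\mathcal{N}_A(U)=\{a\in A\mid au\in U\text{ and }ua\in U\text{ for all }u\in U\}$. A Cartan subalgebra of a Leibniz algebra $N$ is a nilpotent subalgebra $C$ of $N$ such that $\mathcal{N}_N(C)=C$. *)

theory Defs
  imports Complex_Main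
begin

text \<open>The underlying space of the algebra is the whole type \<open>'a\<close>; the field \<open>'f\<close> is arbitrary.
  Products of vector spaces are spans of the sets of products.\<close>

locale leibniz_algebra = vector_space scale
  for scale :: "'f::field \<Rightarrow> 'a::ab_group_add \<Rightarrow> 'a" (infixr \<open>*s\<close> 75) +
  fixes mult :: "'a \<Rightarrow> 'a \<Rightarrow> 'a" (infixl \<open>\<bullet>\<close> 70)
  assumes linear_right: "Vector_Spaces.linear scale scale (\<lambda>b. a \<bullet> b)"
    and linear_left: "Vector_Spaces.linear scale scale (\<lambda>a. a \<bullet> b)"
    and leibniz: "a \<bullet> (b \<bullet> c) = (a \<bullet> b) \<bullet> c + b \<bullet> (a \<bullet> c)"
begin

definition subalgebra :: "'a set \<Rightarrow> bool" where
  "subalgebra U \<longleftrightarrow> subspace U \<and> (\<forall>u\<in>U. \<forall>v\<in>U. u \<bullet> v \<in> U)"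

definition ideal :: "'a set \<Rightarrow> bool" where
  "ideal N \<longleftrightarrow> subspace N \<and> (\<forall>a. \<forall>n\<in>N. a \<bullet> n \<in> N \<and> n \<bullet> a \<in> N)"

definition set_mult :: "'a set \<Rightarrow> 'a set \<Rightarrow> 'a set" where
  "set_mult U V = span {u \<bullet> v | u v. u \<in> U \<and> v \<in> V}"

text \<open>The index is shifted: \<open>lower_central B k\<close> is \<open>B\<^sup>k\<^sup>+\<^sup>1\<close>.\<close>

primrec lower_central :: "'a set \<Rightarrow> nat \<Rightarrow> 'a set" where
  "lower_central B 0 = B"
| "lower_central B (Suc k) = set_mult B (lower_central B k)"

definition nilpotent :: "'a set \<Rightarrow> bool" where
  "nilpotent B \<longleftrightarrow> (\<exists>k. lower_central B k = {0})"

definition normaliser :: "'a set \<Rightarrow> 'a set \<Rightarrow> 'a set" where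
  "normaliser B U = {a \<in> B. \<forall>u\<in>U. a \<bullet> u \<in> U \<and> u \<bullet> a \<in> U}"

definition cartan_subalgebra :: "'a set \<Rightarrow> 'a set \<Rightarrow> bool" where
  "cartan_subalgebra N C \<longleftrightarrow>
     subalgebra C \<and> C \<subseteq> N \<and> nilpotent C \<and> normaliser N C = C"

end

end

theory Submission
  imports Defs
begin

text \<open>Among the subalgebras \<open>B\<close> of \<open>A\<close> with \<open>C \<subseteq> B\<close> and \<open>N + B = A\<close> choose one of least dimension.
  For \<open>c \<in> C\<close>, the Fitting null component of the derivation \<open>b \<mapsto> c b\<close> of \<open>B\<close> is again such a
  subalgebra, so left multiplication by any \<open>c \<in> C\<close> is nilpotent on \<open>B\<close>. If \<open>B \<inter> N\<close> were larger
  than \<open>C\<close>, an Engel type argument on \<open>(B \<inter> N) / C\<close> would give an element of \<open>N - C\<close> normalising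
  \<open>C\<close>. Hence \<open>B \<inter> N = C\<close>, so \<open>C\<close> is an ideal of \<open>B\<close> and \<open>B\<close> normalises \<open>C\<close>.\<close>

locale fd_leibniz_algebra =
  leibniz_algebra scale mult + finite_dimensional_vector_space scale Basis
  for scale :: "'f::field \<Rightarrow> 'a::ab_group_add \<Rightarrow> 'a" (infixr \<open>*s\<close> 75)
    and mult :: "'a \<Rightarrow> 'a \<Rightarrow> 'a" (infixl \<open>\<bullet>\<close> 70)
    and Basis :: "'a set"

section \<open>Left multiplications, Fitting null components and normalisers in arbitrary
  dimension\<close>

context leibniz_algebra
begin

sublocale right: Vector_Spaces.linear scale scale "\<lambda>b. a \<bullet> b" for a
  by (rule linear_right)

sublocale left: Vector_Spaces.linear scale scale "\<lambda>a. a \<bullet> b" for b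
  by (rule linear_left)

lemma linear_funpow_mult: "Vector_Spaces.linear scale scale ((\<bullet>) c ^^ k)"
proof (induction k)
  case 0
  then show ?case by (simp add: id_def linear_id[unfolded id_def])
next
  case (Suc k)
  then show ?case
    using Vector_Spaces.linear_compose[OF Suc linear_right] by (simp add: comp_def)
qed

lemma subspace_subalgebra: "subalgebra U \<Longrightarrow> subspace U"
  by (simp add: subalgebra_def)

lemma subalgebra_mult: "\<lbrakk>subalgebra U; u \<in> U; v \<in> U\<rbrakk> \<Longrightarrow> u \<bullet> v \<in> U"
  by (simp add: subalgebra_def)

lemma lower_central_SucI:
  "\<lbrakk>b \<in> B; x \<in> lower_central B k\<rbrakk> \<Longrightarrow> b \<bullet> x \<in> lower_central B (Suc k)"
  by (auto simp: set_mult_def intro!: span_base)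

lemma lower_central_subset:
  assumes "subalgebra B"
  shows "lower_central B k \<subseteq> B"
proof (induction k)
  case (Suc k)
  have "set_mult B (lower_central B k) \<subseteq> B"
    unfolding set_mult_def
    by (rule span_minimal) (use Suc assms in \<open>auto simp: subalgebra_def\<close>)
  then show ?case by simp
qed simp

lemma funpow_mult_mem:
  assumes "\<And>x. x \<in> U \<Longrightarrow> c \<bullet> x \<in> U" and "x \<in> U"
  shows "((\<bullet>) c ^^ k) x \<in> U"
  using assms by (induction k) auto

lemma funpow_mult_lower_central:
  assumes "c \<in> B" and "x \<in> B"
  shows "((\<bullet>) c ^^ k) x \<in> lower_central B k"
  using assms(2) lower_central_SucI[OF assms(1)]
  by (induction k) (simp_all del: lower_central.simps(2))

sublocale funpow: Vector_Spaces.linear scale scale "(\<bullet>) c ^^ k" for c k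
  by (rule linear_funpow_mult)

lemma funpow_mult_zero_mono:
  assumes "((\<bullet>) c ^^ i) x = 0" and "i \<le> j"
  shows "((\<bullet>) c ^^ j) x = 0"
proof -
  have "((\<bullet>) c ^^ (j - i + i)) x = 0"
    unfolding funpow_add using assms(1) by simp
  then show ?thesis using assms(2) by simp
qed

text \<open>Left multiplication by \<open>c\<close> is a derivation, so applying it once to
  \<open>x \<bullet> y\<close> lowers one of the two exponents by one. Induction on
  \<open>i + j\<close> thus replaces the binomial expansion of the power; an exponent 0 means that
  the factor itself is 0.\<close>

lemma funpow_mult_product_zero:
  assumes "((\<bullet>) c ^^ i) x = 0" and "((\<bullet>) c ^^ j) y = 0"
  shows "((\<bullet>) c ^^ (i + j)) (x \<bullet> y) = 0"
  using assms
proof (induction n \<equiv> "i + j" arbitrary: i j x y)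
  case 0
  then show ?case by simp
next
  case (Suc n)
  show ?case
  proof (cases "i = 0 \<or> j = 0")
    case True
    then show ?thesis using Suc.prems by auto
  next
    case False
    then obtain i' j' where ij: "i = Suc i'" "j = Suc j'"
      by (meson not0_implies_Suc)
    have xy: "((\<bullet>) c ^^ i') (c \<bullet> x) = 0" "((\<bullet>) c ^^ j') (c \<bullet> y) = 0"
      using Suc.prems unfolding ij funpow_Suc_right o_apply .
    have n: "n = i' + j" "n = i + j'" using Suc.hyps(2) ij by linarith+
    have 1: "((\<bullet>) c ^^ n) ((c \<bullet> x) \<bullet> y) = 0"
      using Suc.hyps(1)[OF n(1) xy(1) Suc.prems(2)] unfolding n(1) .
    have 2: "((\<bullet>) c ^^ n) (x \<bullet> (c \<bullet> y)) = 0"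
      using Suc.hyps(1)[OF n(2) Suc.prems(1) xy(2)] unfolding n(2) .
    have "((\<bullet>) c ^^ Suc n) (x \<bullet> y) = ((\<bullet>) c ^^ n) ((c \<bullet> x) \<bullet> y + x \<bullet> (c \<bullet> y))"
      by (simp only: funpow_Suc_right o_apply leibniz[of c x y])
    also have "\<dots> = 0"
      unfolding funpow.add 1 2 by simp
    finally show ?thesis unfolding Suc.hyps(2) .
  qed
qed

text \<open>The generalised eigenspace of left multiplication by \<open>c\<close> for the eigenvalue
  0. The exponent may vary with \<open>x\<close>, so no dimension bound enters.\<close>

definition fitting_null :: "'a \<Rightarrow> 'a set" where
  "fitting_null c = {x. \<exists>k. ((\<bullet>) c ^^ k) x = 0}"

lemma subalgebra_fitting_null: "subalgebra (fitting_null c)"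
  unfolding subalgebra_def
proof (intro conjI ballI)
  show "subspace (fitting_null c)"
    unfolding subspace_def
  proof (intro conjI ballI allI)
    show "0 \<in> fitting_null c" by (simp add: fitting_null_def)
  next
    fix x y assume "x \<in> fitting_null c" "y \<in> fitting_null c"
    then obtain i j where "((\<bullet>) c ^^ i) x = 0" "((\<bullet>) c ^^ j) y = 0"
      by (auto simp: fitting_null_def)
    then have "((\<bullet>) c ^^ max i j) (x + y) = 0"
      using funpow_mult_zero_mono[of i c x "max i j"] funpow_mult_zero_mono[of j c y "max i j"]
      by (simp add: funpow.add)
    then show "x + y \<in> fitting_null c" by (auto simp: fitting_null_def)
  next
    fix r x assume "x \<in> fitting_null c"
    then obtain i where "((\<bullet>) c ^^ i) x = 0" by (auto simp: fitting_null_def)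
    then have "((\<bullet>) c ^^ i) (r *s x) = 0"
      by (simp add: funpow.scale)
    then show "r *s x \<in> fitting_null c" by (auto simp: fitting_null_def)
  qed
next
  fix x y assume "x \<in> fitting_null c" "y \<in> fitting_null c"
  then show "x \<bullet> y \<in> fitting_null c"
    using funpow_mult_product_zero by (fastforce simp: fitting_null_def)
qed

lemma subalgebra_Int: "\<lbrakk>subalgebra U; subalgebra V\<rbrakk> \<Longrightarrow> subalgebra (U \<inter> V)"
  by (auto simp: subalgebra_def intro: subspace_inter)

text \<open>The \<open>k\<close>-th power of left multiplication by \<open>c\<close> maps
  \<open>B\<close> into \<open>lower_central B k\<close>, which is zero for some
  \<open>k\<close>.\<close>

lemma nilpotent_subset_fitting_null:
  assumes "nilpotent B" and "c \<in> B"
  shows "B \<subseteq> fitting_null c"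
  using assms funpow_mult_lower_central[OF assms(2)]
  unfolding nilpotent_def fitting_null_def by fastforce

text \<open>Turns one-sided normalising into two-sided. The required element outside
  \<open>C\<close> is \<open>n\<close> itself or a product \<open>n \<bullet> c\<close>, with
  \<open>c\<close> in the last term of the lower central series before \<open>n\<close> starts to
  multiply the terms into \<open>C\<close>.\<close>

lemma normaliser_not_subset:
  assumes sub: "subalgebra C" and nil: "nilpotent C" and "ideal N"
    and n: "n \<in> N" "n \<notin> C" and left: "\<And>c. c \<in> C \<Longrightarrow> c \<bullet> n \<in> C"
  shows "\<not> normaliser N C \<subseteq> C"
proof -
  have C: "subspace C" using sub by (rule subspace_subalgebra)
  let ?P = "\<lambda>k. \<forall>x\<in>lower_central C k. n \<bullet> x \<in> C"
  obtain K where "lower_central C K = {0}"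
    using nil by (auto simp: nilpotent_def)
  then have "?P K" using subspace_0[OF C] by simp
  \<comment> \<open>Because of the index shift, \<open>k = 0\<close> says that \<open>n\<close>
    multiplies all of \<open>C\<close> into \<open>C\<close>.\<close>
  define k where "k = (LEAST k. ?P k)"
  have k: "?P k" unfolding k_def by (rule LeastI[of ?P, OF \<open>?P K\<close>])
  show ?thesis
  proof (cases k)
    case 0
    then have "n \<in> normaliser N C" using k n left by (simp add: normaliser_def)
    then show ?thesis using n(2) by blast
  next
    case (Suc j)
    then have "\<not> ?P j" unfolding k_def by (intro not_less_Least) simp
    then obtain c where c: "c \<in> lower_central C j" "n \<bullet> c \<notin> C" by blast
    then have "c \<in> C" using lower_central_subset[OF sub] by blast
    \<comment> \<open>Here \<open>a \<bullet> c\<close> lies one term deeper in the series than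
      \<open>c\<close>, where \<open>n\<close> already multiplies into \<open>C\<close>.\<close>
    have "a \<bullet> (n \<bullet> c) \<in> C" if "a \<in> C" for a
    proof -
      have "n \<bullet> (a \<bullet> c) \<in> C"
        using k Suc lower_central_SucI[OF that c(1)] by blast
      moreover have "(a \<bullet> n) \<bullet> c \<in> C"
        using left[OF that] \<open>c \<in> C\<close> subalgebra_mult[OF sub] by blast
      ultimately show ?thesis unfolding leibniz[of a n c] by (intro subspace_add[OF C])
    qed
    moreover have "(n \<bullet> c) \<bullet> a \<in> C" if "a \<in> C" for a
    proof -
      \<comment> \<open>Expanding \<open>n \<bullet> (c \<bullet> a)\<close> and then the resulting
        \<open>c \<bullet> (n \<bullet> a)\<close> brings the first term back; cancelling it trades
        \<open>n \<bullet> c\<close> for \<open>c \<bullet> n\<close>, which is in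
        \<open>C\<close>.\<close>
      have "n \<bullet> (c \<bullet> a) = ((n \<bullet> c) \<bullet> a + (c \<bullet> n) \<bullet> a) + n \<bullet> (c \<bullet> a)"
        by (subst leibniz[of n c a], subst leibniz[of c n a]) (simp only: add.assoc)
      then have "(n \<bullet> c) \<bullet> a = - ((c \<bullet> n) \<bullet> a)"
        by (simp only: add_cancel_right_left eq_neg_iff_add_eq_0)
      then show ?thesis
        using left[OF \<open>c \<in> C\<close>] that subalgebra_mult[OF sub] subspace_neg[OF C] by simp
    qed
    moreover have "n \<bullet> c \<in> N" using \<open>ideal N\<close> n by (simp add: ideal_def)
    ultimately have "n \<bullet> c \<in> normaliser N C" by (simp add: normaliser_def)
    then show ?thesis using c(2) by blast
  qed
qed

end

section \<open>Finite dimension: Fitting decomposition, an Engel type lemma and the minimal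
  supplement \<open>B\<close>\<close>

context fd_leibniz_algebra
begin

text \<open>The existence half of Fitting's lemma, with the second summand only required to lie in
  the image of \<open>c\<close> on \<open>B\<close>. It holds because the descending images of the
  powers become stationary.\<close>

lemma fitting_decomposition:
  assumes B: "subspace B" and inv: "\<And>x. x \<in> B \<Longrightarrow> c \<bullet> x \<in> B" and "b \<in> B"
  obtains e y where "e \<in> B" "e \<in> fitting_null c" "y \<in> B" "b = e + c \<bullet> y"
proof -
  let ?I = "\<lambda>k. ((\<bullet>) c ^^ k) ` B"
  have sub: "subspace (?I k)" for k
    by (rule funpow.subspace_image[OF B])
  have Suc_sub: "?I (Suc k) \<subseteq> ?I k" for k
    unfolding funpow_Suc_right using inv by auto
  have anti: "?I j \<subseteq> ?I i" if "i \<le> j" for i j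
    using lift_Suc_antimono_le[of ?I, OF Suc_sub that] .
  define k where "k = (ARG_MIN (\<lambda>k. dim (?I k)) k. True)"
  have min: "dim (?I k) \<le> dim (?I j)" for j
    unfolding k_def by (rule arg_min_nat_le) simp
  have eq: "?I j = ?I k" if "k \<le> j" for j
    by (rule subspace_dim_equal[OF sub sub anti[OF that] min])
  \<comment> \<open>The exponent \<open>Suc k\<close> rather than \<open>k\<close> guarantees a
    factor \<open>c\<close> to split off, which yields \<open>y\<close>.\<close>
  have "?I (Suc k) = ?I (Suc k + Suc k)"
    by (rule trans[OF eq eq[symmetric]]) simp_all
  then have "((\<bullet>) c ^^ Suc k) b \<in> ?I (Suc k + Suc k)" using \<open>b \<in> B\<close> by blast
  then obtain z where "z \<in> B" "((\<bullet>) c ^^ Suc k) b = ((\<bullet>) c ^^ (Suc k + Suc k)) z"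
    by (rule imageE)
  then have z: "z \<in> B" "((\<bullet>) c ^^ Suc k) b = ((\<bullet>) c ^^ Suc k) (((\<bullet>) c ^^ Suc k) z)"
    unfolding funpow_add o_apply .
  define y where "y = ((\<bullet>) c ^^ k) z"
  have y: "y \<in> B" "((\<bullet>) c ^^ Suc k) z = c \<bullet> y"
    unfolding y_def using funpow_mult_mem[OF inv z(1)] by auto
  have "((\<bullet>) c ^^ Suc k) (b - c \<bullet> y) = 0"
    using z(2) unfolding y(2) funpow.diff by simp
  then have "b - c \<bullet> y \<in> fitting_null c" unfolding fitting_null_def by blast
  moreover have "b - c \<bullet> y \<in> B" using B \<open>b \<in> B\<close> inv y by (simp add: subspace_diff)
  ultimately show thesis using y(1) by (intro that[of "b - c \<bullet> y" y]) simp_all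
qed

text \<open>Engel's theorem for the left action of \<open>C\<close> on \<open>V / C\<close>, phrased
  without the quotient: \<open>n\<close> represents a nonzero vector killed by
  \<open>C\<close>.\<close>

lemma engel_vector:
  assumes sub: "subalgebra C" and nil: "nilpotent C"
    and V: "subspace V" "C \<subset> V" and inv: "\<And>c v. \<lbrakk>c \<in> C; v \<in> V\<rbrakk> \<Longrightarrow> c \<bullet> v \<in> V"
    and null: "\<And>c. c \<in> C \<Longrightarrow> V \<subseteq> fitting_null c"
  obtains n where "n \<in> V" "n \<notin> C" "\<And>c. c \<in> C \<Longrightarrow> c \<bullet> n \<in> C"
proof -
  have C: "subspace C" using sub by (rule subspace_subalgebra)
  let ?Q = "\<lambda>U. subspace U \<and> C \<subset> U \<and> U \<subseteq> V \<and> (\<forall>c\<in>C. \<forall>u\<in>U. c \<bullet> u \<in> U)"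
  have "?Q V" using V inv by auto
  \<comment> \<open>In effect \<open>U / C\<close> is an irreducible submodule of
    \<open>V / C\<close>; the aim is that \<open>C\<close> acts on it as zero.\<close>
  define U where "U = (ARG_MIN dim U. ?Q U)"
  have U: "?Q U" unfolding U_def by (rule arg_min_natI[of ?Q, OF \<open>?Q V\<close>])
  have min: "dim U \<le> dim U'" if "?Q U'" for U'
    unfolding U_def by (rule arg_min_nat_le[of ?Q, OF that])
  obtain K where K: "lower_central C K = {0}"
    using nil by (auto simp: nilpotent_def)
  have step: "\<forall>s\<in>lower_central C k. \<forall>u\<in>U. s \<bullet> u \<in> C"
    if IH: "\<forall>s\<in>lower_central C (Suc k). \<forall>u\<in>U. s \<bullet> u \<in> C" for k
  proof
    fix s assume s: "s \<in> lower_central C k"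
    then have "s \<in> C" using lower_central_subset[OF sub] by blast
    \<comment> \<open>The kernel of \<open>s\<close> on \<open>U / C\<close>. It is nonzero since
      \<open>s\<close> acts nilpotently, and \<open>C\<close>-invariant since
      \<open>c \<bullet> s\<close> lies one term deeper and acts as zero by \<open>IH\<close>;
      minimality then gives \<open>U' = U\<close>.\<close>
    define U' where "U' = {u \<in> U. s \<bullet> u \<in> C}"
    have "subspace U'"
      using U C unfolding U'_def subspace_def
      by (auto simp: right.add right.scale)
    moreover have "C \<subseteq> U'"
      using U \<open>s \<in> C\<close> subalgebra_mult[OF sub] by (auto simp: U'_def)
    moreover have "U' \<noteq> C"
    proof -
      obtain u where u: "u \<in> U" "u \<notin> C" using U by blast
      then have "u \<in> fitting_null s" using null[OF \<open>s \<in> C\<close>] U by blast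
      then obtain i where "((\<bullet>) s ^^ i) u = 0"
        unfolding fitting_null_def by blast
      then have ex: "((\<bullet>) s ^^ i) u \<in> C" using subspace_0[OF C] by simp
      \<comment> \<open>The iterate just before the first one in \<open>C\<close> lies in
        \<open>U'\<close> but not in \<open>C\<close>.\<close>
      define j where "j = (LEAST j. ((\<bullet>) s ^^ j) u \<in> C)"
      have j: "((\<bullet>) s ^^ j) u \<in> C" unfolding j_def
        by (rule LeastI[of "\<lambda>j. ((\<bullet>) s ^^ j) u \<in> C", OF ex])
      obtain l where l: "j = Suc l" using j u(2) by (cases j) auto
      then have "((\<bullet>) s ^^ l) u \<notin> C" unfolding j_def by (intro not_less_Least) simp
      moreover have "((\<bullet>) s ^^ l) u \<in> U"
        using U \<open>s \<in> C\<close> u(1) by (intro funpow_mult_mem) auto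
      then have "((\<bullet>) s ^^ l) u \<in> U'" using j l by (simp add: U'_def)
      ultimately show ?thesis by blast
    qed
    moreover have "c \<bullet> u \<in> U'" if "c \<in> C" "u \<in> U'" for c u
    proof -
      have "(c \<bullet> s) \<bullet> u \<in> C"
        using IH lower_central_SucI[OF that(1) s] that(2) by (simp add: U'_def)
      moreover have "c \<bullet> (s \<bullet> u) \<in> C"
        using that subalgebra_mult[OF sub] by (simp add: U'_def)
      moreover have "s \<bullet> (c \<bullet> u) = c \<bullet> (s \<bullet> u) - (c \<bullet> s) \<bullet> u"
        using leibniz[of c s u] by simp
      ultimately have "s \<bullet> (c \<bullet> u) \<in> C" using subspace_diff[OF C] by simp
      then show ?thesis using that U by (simp add: U'_def)
    qed
    ultimately have "?Q U'" using U by (auto simp: U'_def)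
    then have "U' = U"
      using U min by (intro subspace_dim_equal) (auto simp: U'_def)
    then show "\<forall>u\<in>U. s \<bullet> u \<in> C" by (auto simp: U'_def)
  qed
  have "\<forall>s\<in>lower_central C 0. \<forall>u\<in>U. s \<bullet> u \<in> C"
  \<comment> \<open>The induction descends from the zero term \<open>K\<close> to index 0, which is
    \<open>C\<close> itself.\<close>
  proof (rule inc_induct[of 0 K])
    show "\<forall>s\<in>lower_central C K. \<forall>u\<in>U. s \<bullet> u \<in> C"
      using K subspace_0[OF C] by simp
  qed (use step in auto)
  moreover obtain n where "n \<in> U" "n \<notin> C" using U by blast
  ultimately show thesis using U by (intro that[of n]) auto
qed

lemma ideal_plus_normaliser:
  assumes N: "ideal N" and cartan: "cartan_subalgebra N C"
  shows "{n + x | n x. n \<in> N \<and> x \<in> normaliser UNIV C} = UNIV"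
proof -
  have C: "subalgebra C" "C \<subseteq> N" "nilpotent C" "normaliser N C = C"
    using cartan by (auto simp: cartan_subalgebra_def)
  have subN: "subspace N" using N by (simp add: ideal_def)
  let ?Q = "\<lambda>B. subalgebra B \<and> C \<subseteq> B \<and> (\<forall>a. \<exists>n\<in>N. \<exists>b\<in>B. a = n + b)"
  have "?Q UNIV"
    using subspace_0[OF subN] by (auto simp: subalgebra_def intro!: bexI[of _ 0])
  define B where "B = (ARG_MIN dim B. ?Q B)"
  have B: "?Q B" unfolding B_def by (rule arg_min_natI[of ?Q, OF \<open>?Q UNIV\<close>])
  have min: "dim B \<le> dim B'" if "?Q B'" for B'
    unfolding B_def by (rule arg_min_nat_le[of ?Q, OF that])
  have B': "subalgebra B" "C \<subseteq> B" using B by (simp_all only:)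
  have sum: "\<exists>n\<in>N. \<exists>b\<in>B. a = n + b" for a using B by (simp only:)
  have subB: "subspace B" using B'(1) by (rule subspace_subalgebra)
  have null: "B \<subseteq> fitting_null c" if "c \<in> C" for c
  proof -
    let ?B = "B \<inter> fitting_null c"
    have "subalgebra ?B" by (rule subalgebra_Int[OF B'(1) subalgebra_fitting_null])
    moreover have "C \<subseteq> ?B" using B'(2) nilpotent_subset_fitting_null[OF C(3) that] by blast
    \<comment> \<open>Splitting \<open>b\<close> as \<open>e + c \<bullet> y\<close> costs nothing:
      \<open>c\<close> is in \<open>N\<close>, so the ideal \<open>N\<close> absorbs
      \<open>c \<bullet> y\<close>.\<close>
    moreover have "\<exists>n\<in>N. \<exists>b\<in>?B. a = n + b" for a
    proof -
      obtain n b where nb: "n \<in> N" "b \<in> B" "a = n + b"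
        using sum[of a] by (elim bexE) (rule that)
      obtain e y where ey: "e \<in> B" "e \<in> fitting_null c" "y \<in> B" "b = e + c \<bullet> y"
        by (rule fitting_decomposition[OF subB subalgebra_mult[OF B'(1)] nb(2)])
          (use \<open>c \<in> C\<close> B'(2) in auto)
      have "c \<bullet> y \<in> N" using N that C(2) by (auto simp: ideal_def)
      then have "n + c \<bullet> y \<in> N" using nb subspace_add[OF subN] by blast
      moreover have "a = (n + c \<bullet> y) + e" using nb ey by (simp add: algebra_simps)
      ultimately show ?thesis using ey(1,2)
        by (intro bexI[of _ e] bexI[of _ "n + c \<bullet> y"]) auto
    qed
    ultimately have "?Q ?B" by (intro conjI allI)
    then have "?B = B"
      using min subspace_subalgebra subB by (intro subspace_dim_equal) auto
    then show ?thesis by blast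
  qed
  have BN: "B \<inter> N = C"
  proof (rule ccontr)
    assume "B \<inter> N \<noteq> C"
    then have "C \<subset> B \<inter> N" using B'(2) C(2) by blast
    moreover have "c \<bullet> v \<in> B \<inter> N" if "c \<in> C" "v \<in> B \<inter> N" for c v
      using that N B'(2) C(2) subalgebra_mult[OF B'(1)] by (auto simp: ideal_def)
    ultimately obtain n where "n \<in> B \<inter> N" "n \<notin> C" "\<And>c. c \<in> C \<Longrightarrow> c \<bullet> n \<in> C"
      using engel_vector[OF C(1,3) subspace_inter[OF subB subN]] null by blast
    then show False
      using normaliser_not_subset[OF C(1,3) N] C(4) by blast
  qed
  have "b \<bullet> c \<in> C \<and> c \<bullet> b \<in> C" if "b \<in> B" "c \<in> C" for b c
    using that N subalgebra_mult[OF B'(1)] unfolding BN[symmetric] by (simp add: ideal_def)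
  then have "B \<subseteq> normaliser UNIV C" by (auto simp: normaliser_def)
  then show ?thesis using sum by fast
qed

end

theorem theorem4p6:
  fixes scale :: "'f::field \<Rightarrow> 'a::ab_group_add \<Rightarrow> 'a"
    and mult :: "'a \<Rightarrow> 'a \<Rightarrow> 'a"
    and N C :: "'a set"
  assumes "leibniz_algebra scale mult"
    and "\<exists>Basis. finite_dimensional_vector_space scale Basis"
    and "leibniz_algebra.ideal scale mult N"
    and "leibniz_algebra.cartan_subalgebra scale mult N C"
  shows "{n + x | n x. n \<in> N \<and> x \<in> leibniz_algebra.normaliser mult UNIV C} = UNIV"
proof -
  obtain Basis where "finite_dimensional_vector_space scale Basis"
    using assms(2) by blast
  then interpret fd_leibniz_algebra scale mult Basis
    using assms(1) by (simp add: fd_leibniz_algebra_def)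
  show ?thesis using assms(3,4) by (rule ideal_plus_normaliser)
qed

end
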